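(* Let $(G_n)_{n\ge 1}$ be a sequence of finite groups, not necessarily abelian, with $|G_n|\to\infty$. For each $n$ let $S_n$ be a subset of $G_n$ chosen uniformly at random among all $2^{|G_n|}$ subsets of $G_n$. Then \[ \mathbb{P}\big(S_n+S_n \;=\; S_n-S_n \;=\; G_n\big)\longrightarrow 1 \quad\text{as } n\to\infty . \] In particular, the probability that $|S_n+S_n|=|S_n-S_n|$ tends to $1$.
   Context: The group operation is written additively, $+$, but is not assumed commutative; $-y$ denotes the inverse of $y$. For a subset $S$ of a group $G$, the sumset is $S+S=\{x+y : x,y\in S\}$ and the difference set is $S-S=\{x+(-y) : x,y\in S\}$. *)

theory Defs
  imports "HOL-Probability.Probability" "HOL-Algebra.Coset"
begin

text \<open>
  Groups are not assumed commutative. HOL-Algebra writes group operations multiplicatively, so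
  \<open>x \<otimes>\<^bsub>G\<^esub> y\<close> stands for \<open>x + y\<close> and \<open>inv\<^bsub>G\<^esub> y\<close> for \<open>-y\<close>.
\<close>

definition sumset :: "('a, 'b) monoid_scheme \<Rightarrow> 'a set \<Rightarrow> 'a set" where
  "sumset G S = {x \<otimes>\<^bsub>G\<^esub> y | x y. x \<in> S \<and> y \<in> S}"

definition diffset :: "('a, 'b) monoid_scheme \<Rightarrow> 'a set \<Rightarrow> 'a set" where
  "diffset G S = {x \<otimes>\<^bsub>G\<^esub> (inv\<^bsub>G\<^esub> y) | x y. x \<in> S \<and> y \<in> S}"

definition uniform_subset :: "('a, 'b) monoid_scheme \<Rightarrow> 'a set pmf" where
  "uniform_subset G = pmf_of_set (Pow (carrier G))"

end

theory Submission
  imports Defs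
begin

text \<open>
  A fixed \<open>g\<close> is missing from the sumset (difference set) of \<open>S\<close> iff \<open>S\<close> contains no pair
  \<open>{x, f x}\<close>, where \<open>f\<close> is the permutation \<open>x \<mapsto> x\<inverse> g\<close> (respectively \<open>x \<mapsto> g x\<close>).
  Picking such pairs greedily, each rules out the choice of at most two further ones, and avoiding
  a pair costs a factor of at most 3/4; since \<open>(11/12)\<^sup>3 \<ge> 3/4\<close>, at most \<open>2\<^sup>N (11/12)\<^sup>N\<close> of the
  subsets of a group of order \<open>N\<close> miss \<open>g\<close>. A union bound over \<open>g\<close> finishes the proof.
\<close>

text \<open>The index set \<open>E\<close> is kept apart from the ground set \<open>A\<close>
  because the induction below shrinks both, by different amounts, while \<open>f\<close> stays
  fixed. At a fixed point of \<open>f\<close> the pair degenerates and the condition just forbids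
  that point.\<close>

definition pair_avoiding :: "'a set \<Rightarrow> 'a set \<Rightarrow> ('a \<Rightarrow> 'a) \<Rightarrow> 'a set set" where
  "pair_avoiding A E f = {S. S \<subseteq> A \<and> (\<forall>x\<in>E. \<not> (x \<in> S \<and> f x \<in> S))}"

lemma finite_pair_avoiding: "finite A \<Longrightarrow> finite (pair_avoiding A E f)"
  by (rule finite_subset[of _ "Pow A"]) (auto simp: pair_avoiding_def)

text \<open>Strong induction on \<open>card A\<close>: one pair is removed from \<open>A\<close>,
  and the indices whose pairs meet it are dropped from \<open>E\<close>. The factor 3/4 gained from
  the removed pair pays for at most three dropped indices.\<close>

lemma card_pair_avoiding_le:
  assumes "finite A" "E \<subseteq> A" "f ` E \<subseteq> A" "inj_on f E"
  shows "real (card (pair_avoiding A E f)) \<le> 2 ^ card A * (11/12) ^ card E"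
  using assms
proof (induction "card A" arbitrary: A E rule: less_induct)
  case less
  show ?case
  proof (cases "E = {}")
    case True
    then have "pair_avoiding A E f = Pow A"
      by (auto simp: pair_avoiding_def)
    then show ?thesis
      using True less.prems by (simp add: card_Pow)
  next
    case False
    then obtain x where x: "x \<in> E" by blast
    define T where "T = {x, f x}"
    \<comment> \<open>The remaining indices are those whose pairs are disjoint from
      \<open>T\<close>, so \<open>f\<close> maps \<open>E'\<close> into \<open>A - T\<close> and the
      induction hypothesis applies there.\<close>
    define E' where "E' = {z \<in> E - T. f z \<notin> T}"
    have T: "T \<subseteq> A" "finite T" "T \<noteq> {}"
      using x less.prems by (auto simp: T_def)
    have finE: "finite E" using less.prems finite_subset by blast
    have card_A: "card A = card T + card (A - T)"
      using T less.prems by (metis card_Diff_subset card_mono le_add_diff_inverse)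
    have "card T > 0" using T by (simp add: card_gt_0_iff)
    then have IH: "real (card (pair_avoiding (A - T) E' f)) \<le> 2 ^ card (A - T) * (11/12) ^ card E'"
      using less.prems card_A
      by (intro less.hyps) (auto simp: E'_def intro: inj_on_subset)
    define F where "F = {z \<in> E. f z = x}"
    have "card F \<le> 1"
    proof -
      have "F \<subseteq> {z}" if "z \<in> F" for z
        using that less.prems(4) unfolding F_def inj_on_def by auto
      then have "\<exists>z. F \<subseteq> {z}" by blast
      then show ?thesis
        using card_mono[of "{_}" F] by auto
    qed
    moreover have "card T \<le> 2"
      by (simp add: T_def card_insert_if)
    \<comment> \<open>A dropped index lies in \<open>T\<close>, or is sent to \<open>x\<close> and
      lies in \<open>F\<close>, or is sent to \<open>f x\<close>; by injectivity the last is
      \<open>x\<close> itself, already in \<open>T\<close>. Hence the loss is at most 2 + 1.\<close>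
    moreover have "E \<subseteq> E' \<union> (T \<union> F)"
      using less.prems(4) x unfolding E'_def T_def F_def inj_on_def by auto
    then have "card E \<le> card (E' \<union> (T \<union> F))"
      using finE T by (intro card_mono) (auto simp: E'_def F_def)
    then have "card E \<le> card E' + (card T + card F)"
      using card_Un_le[of E' "T \<union> F"] card_Un_le[of T F] by linarith
    ultimately have "card E \<le> card E' + 3" by linarith
    then have pow: "(11/12::real) ^ (card E' + 3) \<le> (11/12) ^ card E"
      by (intro power_decreasing) auto
    \<comment> \<open>A set is determined by its trace on \<open>T\<close> and its remainder outside
      \<open>T\<close>. The trace is never all of \<open>T\<close>, since \<open>x\<close> is an
      index.\<close>
    have "card (pair_avoiding A E f) \<le> card ((Pow T - {T}) \<times> pair_avoiding (A - T) E' f)"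
    proof (rule card_inj_on_le[where f = "\<lambda>S. (S \<inter> T, S - T)"])
      show "inj_on (\<lambda>S. (S \<inter> T, S - T)) (pair_avoiding A E f)"
        by (auto simp: inj_on_def)
      show "(\<lambda>S. (S \<inter> T, S - T)) ` pair_avoiding A E f
              \<subseteq> (Pow T - {T}) \<times> pair_avoiding (A - T) E' f"
        using x by (auto simp: pair_avoiding_def T_def E'_def)
      show "finite ((Pow T - {T}) \<times> pair_avoiding (A - T) E' f)"
        using T less.prems by (intro finite_cartesian_product finite_pair_avoiding) auto
    qed
    then have "real (card (pair_avoiding A E f))
        \<le> real (card (Pow T - {T})) * real (card (pair_avoiding (A - T) E' f))"
      by (simp add: card_cartesian_product flip: of_nat_mult)
    \<comment> \<open>The bound is tight when \<open>T\<close> has two elements (3 of 4 traces);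
      when \<open>f x = x\<close> only the empty trace is left, 1 of 2.\<close>
    also have "real (card (Pow T - {T})) \<le> 3/4 * 2 ^ card T"
    proof -
      have "card T = 1 \<or> card T = 2"
        using \<open>card T > 0\<close> \<open>card T \<le> 2\<close> by linarith
      then show ?thesis
        using T by (auto simp: card_Diff_subset card_Pow)
    qed
    also have "3/4 * 2 ^ card T * real (card (pair_avoiding (A - T) E' f))
        \<le> 3/4 * 2 ^ card T * (2 ^ card (A - T) * (11/12) ^ card E')"
      using IH by (intro mult_left_mono) auto
    also have "\<dots> = 2 ^ card A * ((11/12) ^ card E' * (3/4))"
      by (simp add: card_A power_add)
    also have "\<dots> \<le> 2 ^ card A * (11/12) ^ (card E' + 3)"
      unfolding power_add by (intro mult_left_mono) (auto simp: power3_eq_cube)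
    also have "\<dots> \<le> 2 ^ card A * (11/12) ^ card E"
      using pow by (intro mult_left_mono) auto
    finally show ?thesis by (simp add: mult_right_mono)
  qed
qed

lemma prob_pair_avoiding_le:
  assumes "finite A" "f ` A \<subseteq> A" "inj_on f A"
  shows "measure_pmf.prob (pmf_of_set (Pow A)) (pair_avoiding A A f) \<le> (11/12) ^ card A"
proof -
  have "Pow A \<inter> pair_avoiding A A f = pair_avoiding A A f"
    by (auto simp: pair_avoiding_def)
  then have "measure_pmf.prob (pmf_of_set (Pow A)) (pair_avoiding A A f)
      = real (card (pair_avoiding A A f)) / 2 ^ card A"
    using assms by (subst measure_pmf_of_set) (auto simp: card_Pow)
  then show ?thesis
    using card_pair_avoiding_le[of A A f] assms by (simp add: divide_le_eq mult.commute)
qed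

lemma prob_sumset_diffset_full_ge:
  fixes G (structure)
  assumes "group G" and fin: "finite (carrier G)"
  shows "measure_pmf.prob (uniform_subset G)
           {S. sumset G S = diffset G S \<and> diffset G S = carrier G}
         \<ge> 1 - 2 * (real (card (carrier G)) * (11/12) ^ card (carrier G))"
    (is "measure_pmf.prob ?M ?full \<ge> _")
proof -
  interpret group G by fact
  let ?C = "carrier G"
  \<comment> \<open>The events \<open>P g\<close> and \<open>D g\<close> say that \<open>g\<close>
    is missed by the sumset and by the difference set:
    \<open>g = x \<otimes> (inv x \<otimes> g)\<close> and
    \<open>g = (g \<otimes> x) \<otimes> inv x\<close>. The order of the factors matters, as the
    group may be noncommutative.\<close>
  define P where "P g = pair_avoiding ?C ?C (\<lambda>x. inv x \<otimes> g)" for g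
  define D where "D g = pair_avoiding ?C ?C (\<lambda>x. g \<otimes> x)" for g
  have P: "measure_pmf.prob ?M (P g) \<le> (11/12) ^ card ?C" if "g \<in> ?C" for g
    unfolding P_def uniform_subset_def using that fin
    by (intro prob_pair_avoiding_le) (auto simp: inj_on_def dest: inj_onD[OF inv_inj])
  have D: "measure_pmf.prob ?M (D g) \<le> (11/12) ^ card ?C" if "g \<in> ?C" for g
    unfolding D_def uniform_subset_def using that fin
    by (intro prob_pair_avoiding_le) (auto simp: inj_on_def)
  \<comment> \<open>The cover is claimed only for subsets of the carrier, which have total
    probability 1; for them both derived sets stay inside the carrier, so missing no
    \<open>g\<close> means equality.\<close>
  have "Pow ?C \<subseteq> ?full \<union> (\<Union>g\<in>?C. P g \<union> D g)"
  proof
    fix S assume S: "S \<in> Pow ?C"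
    show "S \<in> ?full \<union> (\<Union>g\<in>?C. P g \<union> D g)"
    proof (rule ccontr)
      assume neg: "S \<notin> ?full \<union> (\<Union>g\<in>?C. P g \<union> D g)"
      have "g \<in> sumset G S" if g: "g \<in> ?C" for g
      proof -
        have "S \<notin> P g" using neg g by blast
        then obtain x where x: "x \<in> ?C" "x \<in> S" "inv x \<otimes> g \<in> S"
          using S unfolding P_def pair_avoiding_def by blast
        moreover have "g = x \<otimes> (inv x \<otimes> g)"
          using x g by (simp add: m_assoc[symmetric])
        ultimately show ?thesis unfolding sumset_def by blast
      qed
      moreover have "g \<in> diffset G S" if g: "g \<in> ?C" for g
      proof -
        have "S \<notin> D g" using neg g by blast
        then obtain x where x: "x \<in> ?C" "x \<in> S" "g \<otimes> x \<in> S"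
          using S unfolding D_def pair_avoiding_def by blast
        moreover have "g = (g \<otimes> x) \<otimes> inv x"
          using x g by (simp add: m_assoc)
        ultimately show ?thesis unfolding diffset_def by blast
      qed
      moreover have "sumset G S \<subseteq> ?C" "diffset G S \<subseteq> ?C"
        using S by (auto simp: sumset_def diffset_def)
      ultimately show False using neg by blast
    qed
  qed
  then have "measure_pmf.prob ?M (Pow ?C) \<le> measure_pmf.prob ?M (?full \<union> (\<Union>g\<in>?C. P g \<union> D g))"
    by (intro measure_pmf.finite_measure_mono) auto
  also have "\<dots> \<le> measure_pmf.prob ?M ?full + measure_pmf.prob ?M (\<Union>g\<in>?C. P g \<union> D g)"
    by (rule measure_Un_le) auto
  also have "measure_pmf.prob ?M (\<Union>g\<in>?C. P g \<union> D g) \<le> (\<Sum>g\<in>?C. measure_pmf.prob ?M (P g \<union> D g))"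
    using fin by (intro measure_pmf.finite_measure_subadditive_finite) auto
  also have "\<dots> \<le> (\<Sum>g\<in>?C. 2 * (11/12) ^ card ?C)"
  proof (rule sum_mono)
    fix g assume "g \<in> ?C"
    then show "measure_pmf.prob ?M (P g \<union> D g) \<le> 2 * (11/12) ^ card ?C"
      using P[of g] D[of g] measure_Un_le[of "P g" ?M "D g"] by simp
  qed
  also have "measure_pmf.prob ?M (Pow ?C) = 1"
    using fin by (simp add: uniform_subset_def measure_pmf_of_set Pow_not_empty)
  finally show ?thesis by simp
qed

theorem theorem1:
  fixes G :: "nat \<Rightarrow> ('a, 'b) monoid_scheme"
  assumes "\<And>n. n \<ge> 1 \<Longrightarrow> group (G n)"
    and "\<And>n. n \<ge> 1 \<Longrightarrow> finite (carrier (G n))"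
    and "filterlim (\<lambda>n. card (carrier (G n))) at_top sequentially"
  shows "((\<lambda>n. measure_pmf.prob (uniform_subset (G n))
             {S. sumset (G n) S = diffset (G n) S \<and> diffset (G n) S = carrier (G n)})
            \<longlonglongrightarrow> 1)
         \<and> ((\<lambda>n. measure_pmf.prob (uniform_subset (G n))
             {S. card (sumset (G n) S) = card (diffset (G n) S)})
            \<longlonglongrightarrow> 1)"
    (is "(?p \<longlonglongrightarrow> 1) \<and> (?q \<longlonglongrightarrow> 1)")
proof -
  define l where "l N = 1 - 2 * (real N * (11/12) ^ N)" for N :: nat
  have "(\<lambda>N. real N * (11/12::real) ^ N) \<longlonglongrightarrow> 0"
    by (rule powser_times_n_limit_0) auto
  then have "l \<longlonglongrightarrow> 1 - 2 * 0"
    unfolding l_def by (intro tendsto_intros)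
  then have lim: "(\<lambda>n. l (card (carrier (G n)))) \<longlonglongrightarrow> 1"
    using filterlim_compose[OF _ assms(3)] by simp
  have ge: "\<forall>\<^sub>F n in sequentially. l (card (carrier (G n))) \<le> ?p n"
    \<comment> \<open>The group hypotheses start at index 1, so the bound holds only
      eventually.\<close>
    using eventually_ge_at_top[of 1]
    by eventually_elim (use prob_sumset_diffset_full_ge assms(1,2) in \<open>auto simp: l_def\<close>)
  \<comment> \<open>Equal sets have equal cardinalities, so \<open>?q\<close> is squeezed between
    \<open>?p\<close> and 1.\<close>
  have le: "?p n \<le> ?q n" for n
    by (intro measure_pmf.finite_measure_mono) auto
  have p: "?p \<longlonglongrightarrow> 1"
    by (rule tendsto_sandwich[OF ge _ lim tendsto_const]) simp
  have "?q \<longlonglongrightarrow> 1"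
    by (rule tendsto_sandwich[OF _ _ p tendsto_const]) (use le in auto)
  with p show ?thesis ..
qed

end
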